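(* Let $k\ge 2$ and $p_1,\dots,p_k$ be positive integers, let $n=\sum_{i=1}^k p_i$, and let $q$ be an integer with $2\le q\le n-1$. Then $$ar(K_{p_1,\dots,p_k},\mathcal{T}_q)=\ell_q(K_{p_1,\dots,p_k})+1.$$
   Context: All graphs are simple. $K_{p_1,\dots,p_k}$ is the complete $k$-partite graph with partite sets of sizes $p_1,\dots,p_k$. A $t$-edge-coloring of a graph $G$ is a surjective map $E(G)\to\{1,\dots,t\}$ (not necessarily proper). A subgraph is rainbow if its edges receive pairwise distinct colors. For a graph $G$ and a family $\mathcal{C}$ of graphs, the anti-Ramsey number $ar(G,\mathcal{C})$ is the maximum integer $t$ such that there is a $t$-edge-coloring of $G$ in which no rainbow subgraph is isomorphic to a graph in $\mathcal{C}$ (and $0$ if no such coloring exists). $\mathcal{T}_q$ denotes the set of trees with exactly $q$ edges. For a graph $H$ with components $H_1,\dots,H_s$ ordered so that $|V(H_1)|\ge\dots\ge|V(H_s)|$, write $or_i(H)=|V(H_i)|$. $\ell_q(G)$ is the maximum number of edges of a disconnected spanning subgraph $H$ of $G$ such that any two components of $H$ together have at most $q$ vertices (i.e. $or_1(H)+or_2(H)\le q$). *)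

theory Defs
  imports Main
begin

text \<open>
  An edge is the unordered pair of its end points. Only values satisfying
  \<open>simple_graph\<close> represent graphs; all graphs are finite.
\<close>

datatype 'a ugraph = UGraph (verts: "'a set") (edges: "'a set set")

definition simple_graph :: "'a ugraph \<Rightarrow> bool" where
  "simple_graph G \<longleftrightarrow> finite (verts G) \<and>
     (\<forall>e\<in>edges G. \<exists>u v. u \<in> verts G \<and> v \<in> verts G \<and> u \<noteq> v \<and> e = {u, v})"

definition subgraph :: "'a ugraph \<Rightarrow> 'a ugraph \<Rightarrow> bool" where
  "subgraph H G \<longleftrightarrow> simple_graph H \<and> verts H \<subseteq> verts G \<and> edges H \<subseteq> edges G"

definition spanning_subgraph :: "'a ugraph \<Rightarrow> 'a ugraph \<Rightarrow> bool" where
  "spanning_subgraph H G \<longleftrightarrow> subgraph H G \<and> verts H = verts G"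

definition isomorphic :: "'a ugraph \<Rightarrow> 'b ugraph \<Rightarrow> bool" where
  "isomorphic G H \<longleftrightarrow> (\<exists>f. bij_betw f (verts G) (verts H) \<and>
     (\<forall>u\<in>verts G. \<forall>v\<in>verts G. {u, v} \<in> edges G \<longleftrightarrow> {f u, f v} \<in> edges H))"

definition reachable :: "'a ugraph \<Rightarrow> 'a \<Rightarrow> 'a \<Rightarrow> bool" where
  "reachable G u v \<longleftrightarrow> (u, v) \<in> {(x, y). {x, y} \<in> edges G}\<^sup>*"

definition connected_graph :: "'a ugraph \<Rightarrow> bool" where
  "connected_graph G \<longleftrightarrow> verts G \<noteq> {} \<and> (\<forall>u\<in>verts G. \<forall>v\<in>verts G. reachable G u v)"

text \<open>A component is represented by its vertex set.\<close>

definition components :: "'a ugraph \<Rightarrow> 'a set set" where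
  "components G = {{v \<in> verts G. reachable G u v} | u. u \<in> verts G}"

text \<open>
  A cycle is given by the list of its vertices in cyclic order; the edge closing it is
  the one with \<open>Suc i = length xs\<close>.
\<close>

definition is_cycle :: "'a ugraph \<Rightarrow> 'a list \<Rightarrow> bool" where
  "is_cycle G xs \<longleftrightarrow> 3 \<le> length xs \<and> distinct xs \<and>
     (\<forall>i<length xs. {xs ! i, xs ! (Suc i mod length xs)} \<in> edges G)"

definition is_tree :: "'a ugraph \<Rightarrow> bool" where
  "is_tree G \<longleftrightarrow> simple_graph G \<and> connected_graph G \<and> (\<nexists>xs. is_cycle G xs)"

text \<open>
  Families of graphs only matter up to isomorphism. Every finite tree has a copy with
  natural numbers as vertices, so it is enough to collect those.
\<close>

definition trees :: "nat \<Rightarrow> nat ugraph set" where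
  "trees q = {T. is_tree T \<and> card (edges T) = q}"

definition edge_coloring :: "'a ugraph \<Rightarrow> nat \<Rightarrow> ('a set \<Rightarrow> nat) \<Rightarrow> bool" where
  "edge_coloring G t c \<longleftrightarrow> c ` edges G = {1..t}"

definition rainbow :: "('a set \<Rightarrow> nat) \<Rightarrow> 'a ugraph \<Rightarrow> bool" where
  "rainbow c H \<longleftrightarrow> inj_on c (edges H)"

definition rainbow_free_coloring ::
    "'a ugraph \<Rightarrow> 'b ugraph set \<Rightarrow> nat \<Rightarrow> ('a set \<Rightarrow> nat) \<Rightarrow> bool" where
  "rainbow_free_coloring G \<C> t c \<longleftrightarrow> edge_coloring G t c \<and>
     \<not> (\<exists>H. subgraph H G \<and> rainbow c H \<and> (\<exists>F\<in>\<C>. isomorphic H F))"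

text \<open>
  For a simple graph the set below is finite, because a surjective colouring uses at most
  as many colours as there are edges.
\<close>

definition anti_ramsey :: "'a ugraph \<Rightarrow> 'b ugraph set \<Rightarrow> nat" where
  "anti_ramsey G \<C> =
     (if \<exists>t c. rainbow_free_coloring G \<C> t c
      then Max {t. \<exists>c. rainbow_free_coloring G \<C> t c} else 0)"

text \<open>
  The maximum is over a nonempty set when \<open>q \<ge> 2\<close> and \<open>G\<close> is a simple graph with at
  least two vertices: the edgeless spanning subgraph qualifies.
\<close>

definition ell :: "nat \<Rightarrow> 'a ugraph \<Rightarrow> nat" where
  "ell q G = Max {card (edges H) | H. spanning_subgraph H G \<and> \<not> connected_graph H \<and>
     (\<forall>C\<in>components H. \<forall>D\<in>components H. C \<noteq> D \<longrightarrow> card C + card D \<le> q)}"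

text \<open>The \<open>i\<close>-th partite set is \<open>{i} \<times> {1..p i}\<close>.\<close>

definition complete_multipartite :: "nat \<Rightarrow> (nat \<Rightarrow> nat) \<Rightarrow> (nat \<times> nat) ugraph" where
  "complete_multipartite k p =
     (let V = (SIGMA i:{1..k}. {1..p i})
      in UGraph V {{u, v} | u v. u \<in> V \<and> v \<in> V \<and> fst u \<noteq> fst v})"

end

theory Submission
  imports Defs
begin

text \<open>
  For the lower bound, colour an extremal graph for \<open>ell\<close> with distinct colours and all other
  edges with one more colour: a rainbow tree then lies in the union of two components and has
  at most \<open>q\<close> vertices.

  For the upper bound, choose one edge of each colour so that the largest component \<open>A\<close> of the
  resulting graph \<open>R\<close> is as large as possible, and let \<open>B\<close> be a largest component other than
  \<open>A\<close>. The colour of an edge between \<open>v \<in> A\<close> and \<open>B\<close> is the colour of a bridge \<open>f v\<close> of \<open>A\<close>,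
  and the side of \<open>f v\<close> containing \<open>v\<close> has at most \<open>|A| - |B|\<close> vertices. If \<open>v\<close> is chosen so
  that its side is largest, comparison with the other end of \<open>f v\<close> shows that the other side
  is as small. As \<open>|A| \<le> q\<close>, removing \<open>f v\<close> from \<open>R\<close> yields a graph admissible for \<open>ell\<close>
  that has one edge less than there are colours. The only property of complete multipartite
  graphs used is that every vertex is adjacent to an end of every edge.
\<close>

section \<open>Components of edge sets\<close>

definition adj :: "'a set set \<Rightarrow> ('a \<times> 'a) set" where
  "adj S = {(x, y). {x, y} \<in> S}"

text \<open>Taken of a bare edge set, because the argument deletes and inserts single edges while
  the vertex set stays fixed. A vertex on no edge forms a component by itself.\<close>

definition component :: "'a set set \<Rightarrow> 'a \<Rightarrow> 'a set" where
  "component S u = {v. (u, v) \<in> (adj S)\<^sup>*}"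

lemma component_self [simp]: "u \<in> component S u"
  by (simp add: component_def)

lemma component_nonempty [simp]: "component S u \<noteq> {}"
  using component_self[of u S] by (metis empty_iff)

lemma component_sym: "v \<in> component S u \<Longrightarrow> u \<in> component S v"
proof -
  have "sym (adj S)" by (auto simp: sym_def adj_def insert_commute)
  then show "v \<in> component S u \<Longrightarrow> u \<in> component S v"
    by (auto simp: component_def dest: sym_rtrancl symD)
qed

lemma component_trans: "v \<in> component S u \<Longrightarrow> w \<in> component S v \<Longrightarrow> w \<in> component S u"
  by (auto simp: component_def)

lemma component_eq: "v \<in> component S u \<Longrightarrow> component S v = component S u"
  by (blast intro: component_trans component_sym)

lemma component_disjoint: "v \<notin> component S u \<Longrightarrow> component S u \<inter> component S v = {}"
  by (meson component_sym component_trans disjoint_iff)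

lemma component_mono: "S \<subseteq> T \<Longrightarrow> component S u \<subseteq> component T u"
  unfolding component_def adj_def by (auto elim!: rtrancl_mono[THEN subsetD, rotated])

lemma component_edge: "{a, b} \<in> S \<Longrightarrow> a \<in> component S u \<Longrightarrow> b \<in> component S u"
  by (auto simp: component_def adj_def intro: rtrancl_into_rtrancl)

lemma component_induct [consumes 1, case_names base step]:
  assumes "v \<in> component S u" and "P u"
    and "\<And>x y. x \<in> component S u \<Longrightarrow> {x, y} \<in> S \<Longrightarrow> P x \<Longrightarrow> P y"
  shows "P v"
proof -
  from assms(1) have "(u, v) \<in> (adj S)\<^sup>*" by (simp add: component_def)
  then show ?thesis
    by (induction rule: rtrancl_induct) (auto simp: adj_def component_def intro: assms(2) assms(3))
qed

text \<open>A walk from \<open>u\<close> only uses edges with both ends in its component, so it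
  never runs along \<open>f\<close>. Read contrapositively: if deleting \<open>f\<close> changes the
  component, then \<open>f\<close> lies inside it.\<close>

lemma component_delete:
  assumes "\<not> f \<subseteq> component S u"
  shows "component (S - {f}) u = component S u"
proof
  show "component S u \<subseteq> component (S - {f}) u"
  proof
    fix v assume "v \<in> component S u"
    then show "v \<in> component (S - {f}) u"
    proof (induction rule: component_induct)
      case (step x y)
      then have "{x, y} \<subseteq> component S u" using component_edge by fastforce
      then show ?case using step assms component_edge[of x y "S - {f}" u] by auto
    qed simp
  qed
qed (simp add: component_mono)

text \<open>After its last use of the new edge a walk continues inside \<open>S\<close> from
  \<open>a\<close> or from \<open>b\<close>; without such a use it stays in the old component of
  \<open>u\<close>.\<close>

lemma component_insert: "component (insert {a, b} S) u \<subseteq> component S u \<union> component S a \<union> component S b"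
proof
  fix v assume "v \<in> component (insert {a, b} S) u"
  then show "v \<in> component S u \<union> component S a \<union> component S b"
  proof (induction rule: component_induct)
    case (step x y)
    then show ?case
      using component_edge[of x y S] by (auto simp: doubleton_eq_iff)
  qed simp
qed

text \<open>Some step of a walk from \<open>u\<close> to \<open>v\<close> must cross the boundary of
  \<open>W\<close>. This is the edge along which a subtree can be extended.\<close>

lemma component_leaves_set:
  assumes "v \<in> component S u" "u \<in> W" "v \<notin> W"
  obtains a b where "{a, b} \<in> S" "a \<in> W" "b \<notin> W" "b \<in> component S u"
proof -
  have "v \<in> W \<or> (\<exists>a b. {a, b} \<in> S \<and> a \<in> W \<and> b \<notin> W \<and> b \<in> component S u)"
    using assms(1)
  proof (induction rule: component_induct)
    case (step x y)
    then show ?case using component_edge[of x y S u] by blast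
  qed (use assms(2) in simp)
  then show thesis using that assms(3) by blast
qed

lemma component_subset:
  assumes "\<forall>e\<in>S. e \<subseteq> V" "u \<in> V"
  shows "component S u \<subseteq> V"
proof
  fix v assume "v \<in> component S u"
  then show "v \<in> V"
    by (induction rule: component_induct) (use assms in auto)
qed

lemma card_component_2E:
  assumes "2 \<le> card (component S u)"
  obtains b where "{u, b} \<in> S" "b \<in> component S u"
proof -
  obtain v where "v \<in> component S u" "v \<noteq> u"
    using assms by (metis card_2_iff' component_self obtain_subset_with_card_n subset_iff)
  then obtain a b where "{a, b} \<in> S" "a \<in> {u}" "b \<in> component S u"
    using component_leaves_set[of v S u "{u}"] by blast
  then show thesis using that by auto
qed

lemma reachable_iff: "reachable G u v \<longleftrightarrow> v \<in> component (edges G) u"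
  by (simp add: reachable_def component_def adj_def)

lemma connected_iff:
  "connected_graph G \<longleftrightarrow> verts G \<noteq> {} \<and> (\<forall>u\<in>verts G. verts G \<subseteq> component (edges G) u)"
  by (auto simp: connected_graph_def reachable_iff)

lemma simple_graph_edge_subset: "simple_graph G \<Longrightarrow> e \<in> edges G \<Longrightarrow> e \<subseteq> verts G"
  by (auto simp: simple_graph_def)

lemma simple_graph_edgeE:
  assumes "simple_graph G" "e \<in> edges G"
  obtains u v where "e = {u, v}" "u \<in> verts G" "v \<in> verts G" "u \<noteq> v"
  using assms unfolding simple_graph_def by metis

lemma simple_graph_finite_edges: "simple_graph G \<Longrightarrow> finite (edges G)"
  by (rule finite_subset[of _ "Pow (verts G)"]) (auto simp: simple_graph_def)

lemma component_subset_verts: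
  assumes "simple_graph G" "S \<subseteq> edges G" "u \<in> verts G"
  shows "component S u \<subseteq> verts G"
  using assms by (intro component_subset) (auto dest: simple_graph_edge_subset)

text \<open>Edges of a simple graph join vertices, so the restriction to \<open>verts G\<close> in
  \<open>components\<close> removes nothing.\<close>

lemma components_eq:
  assumes "simple_graph G"
  shows "components G = component (edges G) ` verts G"
proof -
  have "{v \<in> verts G. reachable G u v} = component (edges G) u" if "u \<in> verts G" for u
    using component_subset_verts[OF assms order_refl that] by (auto simp: reachable_iff)
  then show ?thesis by (auto simp: components_def)
qed

section \<open>Invariance of trees under isomorphism\<close>

lemma isomorphic_sym:
  assumes "isomorphic G H"
  shows "isomorphic H G"
proof -
  obtain f where f: "bij_betw f (verts G) (verts H)"
    and e: "\<And>u v. u \<in> verts G \<Longrightarrow> v \<in> verts G \<Longrightarrow> {u, v} \<in> edges G \<longleftrightarrow> {f u, f v} \<in> edges H"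
    using assms by (auto simp: isomorphic_def)
  let ?g = "inv_into (verts G) f"
  have "bij_betw ?g (verts H) (verts G)" using f by (rule bij_betw_inv_into)
  moreover have "{u, v} \<in> edges H \<longleftrightarrow> {?g u, ?g v} \<in> edges G"
    if "u \<in> verts H" "v \<in> verts H" for u v
    using that e[of "?g u" "?g v"] f calculation
    by (simp add: bij_betw_inv_into_right bij_betw_apply)
  ultimately show ?thesis by (auto simp: isomorphic_def)
qed

lemma isomorphic_connected:
  assumes "isomorphic G H" "simple_graph G" "connected_graph G"
  shows "connected_graph H"
proof -
  obtain f where f: "bij_betw f (verts G) (verts H)"
    and e: "\<And>u v. u \<in> verts G \<Longrightarrow> v \<in> verts G \<Longrightarrow> {u, v} \<in> edges G \<longleftrightarrow> {f u, f v} \<in> edges H"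
    using assms by (auto simp: isomorphic_def)
  have *: "f v \<in> component (edges H) (f u)" if "v \<in> component (edges G) u" for u v
    using that
  proof (induction rule: component_induct)
    case (step x y)
    then have "{x, y} \<subseteq> verts G" using simple_graph_edge_subset[OF assms(2)] by blast
    then show ?case using step e component_edge by (metis insert_subset)
  qed simp
  have "verts H = f ` verts G" using f by (simp add: bij_betw_def)
  moreover have "verts G \<subseteq> component (edges G) u" if "u \<in> verts G" for u
    using assms(3) that by (simp add: connected_iff)
  ultimately show ?thesis using assms(3) * by (fastforce simp: connected_iff)
qed

lemma isomorphic_cycle:
  assumes "isomorphic G H" "simple_graph G" "is_cycle G xs"
  shows "\<exists>ys. is_cycle H ys"
proof -
  obtain f where f: "bij_betw f (verts G) (verts H)"
    and e: "\<And>u v. u \<in> verts G \<Longrightarrow> v \<in> verts G \<Longrightarrow> {u, v} \<in> edges G \<longleftrightarrow> {f u, f v} \<in> edges H"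
    using assms by (auto simp: isomorphic_def)
  have c: "3 \<le> length xs" "distinct xs"
    "\<And>i. i < length xs \<Longrightarrow> {xs ! i, xs ! (Suc i mod length xs)} \<in> edges G"
    using assms(3) by (auto simp: is_cycle_def)
  have V: "xs ! i \<in> verts G" if "i < length xs" for i
    using simple_graph_edge_subset[OF assms(2) c(3)[OF that]] by simp
  then have "set xs \<subseteq> verts G" by (auto simp: in_set_conv_nth)
  then have "inj_on f (set xs)" using f by (auto simp: bij_betw_def intro: inj_on_subset)
  moreover have "{f (xs ! i), f (xs ! (Suc i mod length xs))} \<in> edges H" if "i < length xs" for i
  proof -
    have "Suc i mod length xs < length xs" using that by (intro mod_less_divisor) auto
    then show ?thesis using e V that c(3) by blast
  qed
  moreover have "Suc i mod length xs < length xs" if "i < length xs" for i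
    using that by (intro mod_less_divisor) auto
  ultimately have "is_cycle H (map f xs)"
    using c by (simp add: is_cycle_def distinct_map)
  then show ?thesis ..
qed

lemma isomorphic_tree:
  assumes "isomorphic G H" "simple_graph H" "is_tree G"
  shows "is_tree H"
  using assms isomorphic_connected isomorphic_cycle isomorphic_sym unfolding is_tree_def by metis

text \<open>Needed because the members of \<open>trees q\<close> have natural numbers as vertices: a
  tree found in an arbitrary graph has to be copied there.\<close>

lemma ex_isomorphic_nat_graph:
  assumes "simple_graph G"
  obtains H :: "nat ugraph" where
    "simple_graph H" "isomorphic G H" "card (edges H) = card (edges G)"
proof -
  obtain f where f: "bij_betw f (verts G) {0..<card (verts G)}"
    using ex_bij_betw_finite_nat assms by (auto simp: simple_graph_def)
  define H where "H = UGraph {0..<card (verts G)} ((`) f ` edges G)"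
  have inj: "inj_on f (verts G)" using f by (simp add: bij_betw_def)
  have sub: "e \<in> edges G \<Longrightarrow> e \<subseteq> verts G" for e
    using assms by (rule simple_graph_edge_subset)
  have "\<exists>u v. u \<in> verts H \<and> v \<in> verts H \<and> u \<noteq> v \<and> e = {u, v}" if e: "e \<in> edges H" for e
  proof -
    obtain u v where "u \<in> verts G" "v \<in> verts G" "u \<noteq> v" "e = f ` {u, v}"
      using e assms unfolding H_def simple_graph_def by fastforce
    then show ?thesis using f inj
      by (intro exI[of _ "f u"] exI[of _ "f v"]) (auto simp: H_def inj_on_def bij_betw_def)
  qed
  then have 1: "simple_graph H" unfolding simple_graph_def by (auto simp: H_def)
  have "{u, v} \<in> edges G \<longleftrightarrow> {f u, f v} \<in> edges H" if "u \<in> verts G" "v \<in> verts G" for u v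
  proof
    assume "{f u, f v} \<in> edges H"
    then obtain e where e: "e \<in> edges G" "f ` {u, v} = f ` e" by (auto simp: H_def)
    then have "{u, v} = e"
      using inj_on_image_eq_iff[OF inj, of "{u, v}" e] sub that by blast
    then show "{u, v} \<in> edges G" using e by simp
  next
    assume "{u, v} \<in> edges G"
    then have "f ` {u, v} \<in> edges H" unfolding H_def by (simp del: image_insert)
    then show "{f u, f v} \<in> edges H" by simp
  qed
  then have 2: "isomorphic G H" using f unfolding isomorphic_def by (auto simp: H_def)
  have "inj_on ((`) f) (edges G)"
    using inj_on_image_Pow[OF inj] sub by (auto intro: inj_on_subset)
  then have "card (edges H) = card (edges G)" by (simp add: H_def card_image)
  with 1 2 show thesis by (rule that)
qed

section \<open>Trees inside components\<close>

text \<open>A cycle through the new vertex \<open>b\<close> would have \<open>a\<close> as both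
  neighbours of \<open>b\<close>, although its vertices are distinct and at least three; a cycle
  avoiding \<open>b\<close> would already lie in \<open>T\<close>.\<close>

lemma is_tree_add_leaf:
  assumes T: "is_tree (UGraph W T)" and a: "a \<in> W" and b: "b \<notin> W"
  shows "is_tree (UGraph (insert b W) (insert {a, b} T))"
proof -
  let ?G = "UGraph (insert b W) (insert {a, b} T)"
  have s: "simple_graph (UGraph W T)" using T by (simp add: is_tree_def)
  have sub: "e \<subseteq> W" if "e \<in> T" for e
    using simple_graph_edge_subset[OF s] that by simp
  have "\<exists>u v. u \<in> verts ?G \<and> v \<in> verts ?G \<and> u \<noteq> v \<and> e = {u, v}" if "e \<in> edges ?G" for e
  proof (cases "e \<in> T")
    case True
    then show ?thesis using s unfolding simple_graph_def by fastforce
  next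
    case False
    then show ?thesis using a b that by auto
  qed
  then have 1: "simple_graph ?G" using s by (auto simp: simple_graph_def)
  have "W \<subseteq> component (insert {a, b} T) a"
    using T a component_mono[of T "insert {a, b} T" a] by (auto simp: is_tree_def connected_iff)
  then have "insert b W \<subseteq> component (insert {a, b} T) a"
    using component_edge[of a b "insert {a, b} T" a] by simp
  moreover from this have "component (insert {a, b} T) u = component (insert {a, b} T) a"
    if "u \<in> insert b W" for u
    using that by (intro component_eq) (rule subsetD)
  ultimately have 2: "connected_graph ?G"
    unfolding connected_iff ugraph.sel by blast
  have "\<not> is_cycle ?G xs" for xs
  proof
    assume c: "is_cycle ?G xs"
    let ?n = "length xs"
    have n: "3 \<le> ?n" and d: "distinct xs"
      and E: "\<And>i. i < ?n \<Longrightarrow> {xs ! i, xs ! (Suc i mod ?n)} \<in> insert {a, b} T"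
      using c by (auto simp: is_cycle_def)
    show False
    proof (cases "b \<in> set xs")
      case False
      then have "{xs ! i, xs ! (Suc i mod ?n)} \<in> T" if "i < ?n" for i
      proof -
        have "Suc i mod ?n < ?n" using that by (intro mod_less_divisor) auto
        then have "xs ! i \<noteq> b" "xs ! (Suc i mod ?n) \<noteq> b" using False that by (auto dest: nth_mem)
        then show ?thesis using E[OF that] by (auto simp: doubleton_eq_iff)
      qed
      then have "is_cycle (UGraph W T) xs" using n d by (simp add: is_cycle_def)
      then show False using T by (auto simp: is_tree_def)
    next
      case True
      then obtain i where i: "i < ?n" "xs ! i = b" by (auto simp: in_set_conv_nth)
      \<comment> \<open>The cyclic predecessor of position \<open>i\<close>; index 0 is treated
        apart because subtraction truncates.\<close>
      define j where "j = (if i = 0 then ?n - 1 else i - 1)"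
      have j: "j < ?n" "Suc j mod ?n = i" using i n by (auto simp: j_def)
      let ?s = "Suc i mod ?n"
      have s': "?s < ?n" using i by (intro mod_less_divisor) auto
      have "?s \<noteq> j"
        using i n by (auto simp: j_def mod_Suc split: if_splits)
      moreover have "{b, xs ! ?s} \<notin> T" "{xs ! j, b} \<notin> T" using b sub by auto
      then have "xs ! ?s = a" "xs ! j = a"
        using E[OF i(1)] E[OF j(1)] i j(2) by (auto simp: doubleton_eq_iff)
      ultimately show False using nth_eq_iff_index_eq[OF d s' j(1)] by simp
    qed
  qed
  with 1 2 show ?thesis by (simp add: is_tree_def)
qed

text \<open>Start at \<open>u\<close> and attach leaves: as long as the tree does not fill the
  component, some edge of \<open>S\<close> leaves it.\<close>

lemma ex_subtree:
  assumes "m < card (component S u)"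
  shows "\<exists>W T. T \<subseteq> S \<and> W \<subseteq> component S u \<and> u \<in> W \<and> card W = Suc m \<and> card T = m \<and>
           is_tree (UGraph W T)"
  using assms
proof (induction m)
  case 0
  \<comment> \<open>The index 0 refutes a cycle: a list of length at least 3 would need an edge
    there, and there are none.\<close>
  have "is_tree (UGraph {u} {})"
    by (auto simp: is_tree_def simple_graph_def connected_iff is_cycle_def intro!: exI[of _ 0])
  then show ?case by (intro exI[of _ "{u}"] exI[of _ "{}"]) simp
next
  case (Suc m)
  then obtain W T where W: "T \<subseteq> S" "W \<subseteq> component S u" "u \<in> W" "card W = Suc m" "card T = m"
    "is_tree (UGraph W T)" by auto
  then obtain v where "v \<in> component S u" "v \<notin> W" using Suc.prems
    by (metis less_irrefl subsetI subset_antisym)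
  then obtain a b where ab: "{a, b} \<in> S" "a \<in> W" "b \<notin> W" "b \<in> component S u"
    using component_leaves_set W(3) by metis
  have s: "simple_graph (UGraph W T)" using W by (simp add: is_tree_def)
  then have "finite W" "finite T"
    using simple_graph_finite_edges[OF s] by (simp_all add: simple_graph_def)
  moreover have "{a, b} \<notin> T" using simple_graph_edge_subset[OF s] ab by auto
  ultimately show ?case using W ab is_tree_add_leaf[OF W(6) ab(2,3)]
    by (intro exI[of _ "insert b W"] exI[of _ "insert {a, b} T"]) auto
qed

text \<open>Extend the path along the walk, and cut it back whenever the walk returns to a vertex
  already on it.\<close>

lemma ex_distinct_path:
  assumes "v \<in> component S u"
  shows "\<exists>xs. xs \<noteq> [] \<and> distinct xs \<and> xs ! 0 = u \<and> last xs = v \<and>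
           (\<forall>i. Suc i < length xs \<longrightarrow> {xs ! i, xs ! Suc i} \<in> S)"
  using assms
proof (induction rule: component_induct)
  case base
  show ?case by (intro exI[of _ "[u]"]) simp
next
  case (step x y)
  then obtain xs where xs: "xs \<noteq> []" "distinct xs" "xs ! 0 = u" "last xs = x"
    "\<And>i. Suc i < length xs \<Longrightarrow> {xs ! i, xs ! Suc i} \<in> S" by blast
  show ?case
  proof (cases "y \<in> set xs")
    case True
    then obtain i where "i < length xs" "xs ! i = y" by (auto simp: in_set_conv_nth)
    \<comment> \<open>The prefix ending at the earlier occurrence of \<open>y\<close> is
      kept.\<close>
    then show ?thesis using xs
      by (intro exI[of _ "take (Suc i) xs"]) (auto simp: last_conv_nth)
  next
    case False
    have "{(xs @ [y]) ! i, (xs @ [y]) ! Suc i} \<in> S" if "Suc i < length (xs @ [y])" for i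
    proof (cases "Suc i = length xs")
      case True
      then have "xs ! i = x" using xs by (simp add: last_conv_nth flip: True)
      then show ?thesis using True step by (simp add: nth_append)
    qed (use that xs(5) in \<open>simp add: nth_append\<close>)
    then show ?thesis using xs False
      by (intro exI[of _ "xs @ [y]"]) (auto simp: nth_append)
  qed
qed

text \<open>With too many edges, a spanning tree \<open>T\<close> with
  \<open>card (verts G) - 1\<close> edges would miss an edge of \<open>G\<close>, and the path in
  \<open>T\<close> between its ends would close to a cycle.\<close>

lemma is_tree_card:
  assumes "is_tree G"
  shows "card (edges G) < card (verts G)"
proof (rule ccontr)
  assume neg: "\<not> ?thesis"
  have s: "simple_graph G" and c: "connected_graph G" using assms by (auto simp: is_tree_def)
  then obtain u where u: "u \<in> verts G" by (auto simp: connected_graph_def)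
  have fin: "finite (verts G)" using s by (simp add: simple_graph_def)
  have V: "component (edges G) u = verts G"
    using c u component_subset_verts[OF s order_refl u] by (auto simp: connected_iff)
  have pos: "0 < card (verts G)" using u fin by (auto simp: card_gt_0_iff)
  then obtain W T where W: "T \<subseteq> edges G" "W \<subseteq> verts G" "card W = card (verts G)"
    "card T = card (verts G) - 1" "is_tree (UGraph W T)"
    using ex_subtree[of "card (verts G) - 1" "edges G" u] V by auto
  have WV: "W = verts G" using card_subset_eq[OF fin W(2,3)] .
  have "T \<noteq> edges G" using W(4) neg pos by auto
  then obtain e where e: "e \<in> edges G" "e \<notin> T" using W(1) by auto
  then obtain a b where ab: "a \<in> verts G" "b \<in> verts G" "a \<noteq> b" "e = {a, b}"
    using s by (auto simp: simple_graph_def)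
  have "b \<in> component T a" using W(5) ab WV by (auto simp: is_tree_def connected_iff)
  then obtain xs where xs: "xs \<noteq> []" "distinct xs" "xs ! 0 = a" "last xs = b"
    "\<And>i. Suc i < length xs \<Longrightarrow> {xs ! i, xs ! Suc i} \<in> T"
    using ex_distinct_path[of b T a] by blast
  have last: "xs ! (length xs - 1) = b" using xs by (simp add: last_conv_nth)
  have "length xs \<noteq> 1" using last xs(3) ab(3) by auto
  \<comment> \<open>A path with two vertices would be the edge \<open>e\<close> itself, which is not
    in \<open>T\<close>.\<close>
  moreover have "length xs \<noteq> 2" using last xs(3) xs(5)[of 0] e ab by auto
  ultimately have n: "3 \<le> length xs" using xs(1) by (cases xs; cases "tl xs") (auto simp: Suc_le_eq)
  have "{xs ! i, xs ! (Suc i mod length xs)} \<in> edges G" if i: "i < length xs" for i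
  proof (cases "Suc i = length xs")
    case True
    then have "xs ! i = b" using last by (simp flip: True)
    then show ?thesis using True xs(3) e ab by (simp add: insert_commute)
  next
    case False
    then show ?thesis using xs(5)[of i] i W(1) by auto
  qed
  then have "is_cycle G xs" using n xs(2) by (simp add: is_cycle_def)
  then show False using assms by (simp add: is_tree_def)
qed

text \<open>A larger component contains a tree with \<open>q\<close> edges, and every subset of the
  rainbow set \<open>S\<close> is rainbow.\<close>

lemma rainbow_component_card_le:
  assumes "simple_graph G" "rainbow_free_coloring G (trees q) t c"
    and "S \<subseteq> edges G" "inj_on c S" "u \<in> verts G"
  shows "card (component S u) \<le> q"
proof (rule ccontr)
  assume "\<not> ?thesis"
  then obtain W T where W: "T \<subseteq> S" "W \<subseteq> component S u" "card T = q" "is_tree (UGraph W T)"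
    using ex_subtree[of q S u] by auto
  have s: "simple_graph (UGraph W T)" using W(4) by (simp add: is_tree_def)
  then obtain H :: "nat ugraph" where H: "simple_graph H" "isomorphic (UGraph W T) H"
    "card (edges H) = q" using ex_isomorphic_nat_graph W(3) by (metis ugraph.sel(2))
  then have "H \<in> trees q" using isomorphic_tree[OF H(2,1) W(4)] by (simp add: trees_def)
  moreover have "subgraph (UGraph W T) G"
    using s W component_subset_verts[OF assms(1,3,5)] assms(3) by (auto simp: subgraph_def)
  moreover have "rainbow c (UGraph W T)"
    using W(1) assms(4) by (auto simp: rainbow_def intro: inj_on_subset)
  ultimately show False using assms(2) H(2) by (auto simp: rainbow_free_coloring_def)
qed


section \<open>Transversals of the colour classes and bridges of a largest component\<close>

definition transversal :: "'a set set \<Rightarrow> ('a set \<Rightarrow> nat) \<Rightarrow> 'a set set \<Rightarrow> bool" where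
  "transversal E c S \<longleftrightarrow> S \<subseteq> E \<and> inj_on c S \<and> c ` S = c ` E"

lemma transversal_exchange:
  assumes "transversal E c S" "f \<in> S" "e \<in> E" "c e = c f"
  shows "transversal E c (insert e (S - {f}))"
  using assms unfolding transversal_def
  by (intro conjI) (blast, simp add: inj_on_def, blast, fastforce)

text \<open>The colour of an edge leaving a largest component is the colour of a bridge \<open>{x, y}\<close> of
  that component: otherwise exchanging the two edges would enlarge the component.\<close>

lemma colour_of_leaving_edge:
  assumes G: "simple_graph G"
    and R: "transversal (edges G) c R"
    and max: "\<And>S u. transversal (edges G) c S \<Longrightarrow> u \<in> verts G \<Longrightarrow>
                card (component S u) \<le> card (component R a)"
    and a: "a \<in> verts G" and v: "v \<in> component R a"
    and b: "b \<in> verts G" "b \<notin> component R a" and vb: "{v, b} \<in> edges G"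
  obtains x y where "{x, y} \<in> R"
    "x \<in> component (R - {{x, y}}) v" "y \<notin> component (R - {{x, y}}) v"
    "component R a = component (R - {{x, y}}) v \<union> component (R - {{x, y}}) y"
    "card (component (R - {{x, y}}) v) + card (component R b) \<le> card (component R a)"
proof -
  have RE: "R \<subseteq> edges G" using R by (simp add: transversal_def)
  have "c {v, b} \<in> c ` R" using R vb by (auto simp: transversal_def)
  then obtain f where f: "f \<in> R" "c {v, b} = c f" by auto
  define R0 where "R0 = R - {f}"
  have R0E: "R0 \<subseteq> edges G" "R0 \<subseteq> R" using RE by (auto simp: R0_def)
  have va: "component R v = component R a" using v by (rule component_eq)
  have vG: "v \<in> verts G" using component_subset_verts[OF G RE a] v by auto
  have fin: "finite (component S u)" if "S \<subseteq> edges G" "u \<in> verts G" for S u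
    using component_subset_verts[OF G that] G finite_subset by (auto simp: simple_graph_def)
  have disj: "component R v \<inter> component R b = {}"
    using b(2) va by (intro component_disjoint) simp
  have sub: "component R0 u \<subseteq> component R u" for u using R0E by (intro component_mono)
  let ?R' = "insert {v, b} R0"
  have "card (component R0 v) + card (component R0 b) = card (component R0 v \<union> component R0 b)"
    using fin[OF R0E(1)] vG b(1) disj sub[of v] sub[of b]
    by (intro card_Un_disjoint[symmetric]) auto
  \<comment> \<open>The new edge \<open>{v, b}\<close> joins the two components.\<close>
  also have "\<dots> \<le> card (component ?R' v)"
  proof (intro card_mono fin)
    have "b \<in> component ?R' v" by (rule component_edge[of v]) auto
    then have "component ?R' b = component ?R' v" by (rule component_eq)
    moreover have "component R0 u \<subseteq> component ?R' u" for u by (intro component_mono) auto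
    ultimately show "component R0 v \<union> component R0 b \<subseteq> component ?R' v" by blast
  qed (use R0E vb vG in auto)
  \<comment> \<open>\<open>?R'\<close> is again a transversal, since \<open>{v, b}\<close> has the
    colour of \<open>f\<close>, so the maximality of \<open>component R a\<close> applies.\<close>
  also have "\<dots> \<le> card (component R a)"
    using transversal_exchange[OF R f(1) vb f(2)] vG by (intro max) (simp_all add: R0_def)
  finally have le: "card (component R0 v) + card (component R0 b) \<le> card (component R a)" .
  have "card (component R0 b) > 0"
    using fin[OF R0E(1) b(1)] by (simp add: card_gt_0_iff)
  \<comment> \<open>The component of \<open>b\<close> is nonempty, so the bound is strict for
    \<open>v\<close>: deleting \<open>f\<close> has shrunk its component, which forces
    \<open>f\<close> to lie inside it.\<close>
  then have ne: "component R0 v \<noteq> component R v" using le va by auto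
  then have fA: "f \<subseteq> component R v" using component_delete[of f R v] by (auto simp: R0_def)
  have "f \<noteq> {}" using f(1) RE G by (auto simp: simple_graph_def)
  then have "component R0 b = component R b"
    unfolding R0_def using fA disj by (intro component_delete) blast
  with le have le: "card (component R0 v) + card (component R b) \<le> card (component R a)" by simp
  obtain x0 y0 where "f = {x0, y0}" using f(1) RE G unfolding simple_graph_def by blast
  then have fR: "R = insert {x0, y0} R0" using f(1) by (auto simp: R0_def)
  have split: "component R v = component R0 x0 \<union> component R0 y0"
  proof -
    have "x0 \<in> component R v" "y0 \<in> component R v" using fA \<open>f = {x0, y0}\<close> by auto
    then have 1: "component R x0 = component R v" "component R y0 = component R v"
      using component_eq by metis+
    have "component R x0 \<subseteq> component R0 x0 \<union> component R0 y0"
      using component_insert[of x0 y0 R0 x0] unfolding fR[symmetric] by simp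
    then show ?thesis using sub[of x0] sub[of y0] unfolding 1 by blast
  qed
  have "v \<in> component R0 x0 \<or> v \<in> component R0 y0" using split component_self[of v R] by blast
  \<comment> \<open>The ends of \<open>f\<close> are named so that \<open>x\<close> is on the side
    of \<open>v\<close>.\<close>
  then obtain x y where xy: "f = {x, y}" "v \<in> component R0 x"
    "component R v = component R0 x \<union> component R0 y"
    using split \<open>f = {x0, y0}\<close> by (metis Un_commute insert_commute)
  have xv: "component R0 v = component R0 x" using xy(2) by (rule component_eq)
  have "y \<notin> component R0 v"
  proof
    assume "y \<in> component R0 v"
    then have "component R0 y = component R0 v" by (rule component_eq)
    then show False using ne xy(3) xv by simp
  qed
  then show thesis
    using f(1) le va xv xy by (intro that[of x y]) (simp_all add: R0_def)
qed

text \<open>\<open>nonadj\<close> says that non-adjacency is transitive, the characteristic property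
  of complete multipartite graphs. If the component of \<open>b\<close> contains an edge, it gives
  every \<open>v\<close> in the largest component a neighbour there, hence a bridge, and an extremal
  choice of \<open>v\<close> bounds both sides. If that component is a single vertex, one bridge
  suffices.\<close>

lemma ex_bridge_small_sides:
  assumes G: "simple_graph G"
    and nonadj: "\<And>u v w. {u, v} \<in> edges G \<Longrightarrow> w \<in> verts G \<Longrightarrow> {w, u} \<in> edges G \<or> {w, v} \<in> edges G"
    and R: "transversal (edges G) c R"
    and max: "\<And>S u. transversal (edges G) c S \<Longrightarrow> u \<in> verts G \<Longrightarrow>
                card (component S u) \<le> card (component R a)"
    and a: "a \<in> verts G"
    and b: "b \<in> verts G" "b \<notin> component R a"
    and bmax: "\<And>u. u \<in> verts G \<Longrightarrow> u \<notin> component R a \<Longrightarrow>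
                 card (component R u) \<le> card (component R b)"
    and ne: "edges G \<noteq> {}"
  obtains x y where "{x, y} \<in> R" "y \<notin> component (R - {{x, y}}) x"
    "component R a = component (R - {{x, y}}) x \<union> component (R - {{x, y}}) y"
    "card (component (R - {{x, y}}) x) + card (component R b) \<le> card (component R a)"
    "card (component (R - {{x, y}}) y) + card (component R b) \<le> card (component R a)"
proof -
  have RE: "R \<subseteq> edges G" using R by (simp add: transversal_def)
  have fin: "finite (component S u)" if "S \<subseteq> edges G" "u \<in> verts G" for S u
    using component_subset_verts[OF G that] G finite_subset by (auto simp: simple_graph_def)
  have subV: "component S u \<subseteq> verts G" if "S \<subseteq> edges G" "u \<in> verts G" for S u
    using component_subset_verts[OF G that] .
  define A where "A = component R a"
  \<comment> \<open>\<open>P v x y\<close>: \<open>{x, y}\<close> is a bridge belonging to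
    \<open>v\<close>, with \<open>x\<close> on the side of \<open>v\<close>.\<close>
  define P where "P v x y \<longleftrightarrow> {x, y} \<in> R \<and>
    x \<in> component (R - {{x, y}}) v \<and> y \<notin> component (R - {{x, y}}) v \<and>
    A = component (R - {{x, y}}) v \<union> component (R - {{x, y}}) y \<and>
    card (component (R - {{x, y}}) v) + card (component R b) \<le> card A" for v x y
  have exP: "\<exists>x y. P v x y" if v: "v \<in> A" and w: "w \<in> verts G" "w \<notin> A" "{v, w} \<in> edges G"
      "card (component R w) = card (component R b)" for v w
    using colour_of_leaving_edge[OF G R max a v[unfolded A_def] w(1) w(2)[unfolded A_def] w(3)] w(4)
    unfolding P_def A_def by metis
  show thesis
  proof (cases "2 \<le> card (component R b)")
    case True
    then obtain w where w: "{b, w} \<in> R" "w \<in> component R b" by (rule card_component_2E)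
    have wA: "w \<notin> A" using w(2) b(2) component_disjoint[of b R a] by (auto simp: A_def)
    have wG: "w \<in> verts G" using subV[OF RE b(1)] w(2) by auto
    have "\<exists>x y. P v x y" if "v \<in> A" for v
    proof -
      have "v \<in> verts G" using that subV[OF RE a] by (auto simp: A_def)
      \<comment> \<open>Both ends of the edge \<open>{b, w}\<close> lie in the same component, so
        either neighbour serves.\<close>
      then have "{v, b} \<in> edges G \<or> {v, w} \<in> edges G" using nonadj w(1) RE by blast
      then show ?thesis
        using exP[OF that b(1)] exP[OF that wG wA] b(2) component_eq[OF w(2)] by (auto simp: A_def)
    qed
    then obtain X Y where XY: "\<And>v. v \<in> A \<Longrightarrow> P v (X v) (Y v)" by metis
    \<comment> \<open>The size of the side of \<open>v\<close> at its own bridge; below,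
      \<open>v\<close> maximises it.\<close>
    define m where "m v = card (component (R - {{X v, Y v}}) v)" for v
    have finA: "finite A" unfolding A_def by (rule fin[OF RE a])
    have "A \<noteq> {}" by (simp add: A_def)
    then obtain v where v: "v \<in> A" "\<And>u. u \<in> A \<Longrightarrow> m u \<le> m v"
      using Max_in[of "m ` A"] Max_ge[of "m ` A"] finA
      by (metis (no_types, lifting) finite_imageI image_iff image_is_empty)
    define x y f where "x = X v" and "y = Y v" and "f = {x, y}"
    have f: "f \<in> R" "x \<in> component (R - {f}) v" "y \<notin> component (R - {f}) v"
      "A = component (R - {f}) v \<union> component (R - {f}) y"
      "card (component (R - {f}) v) + card (component R b) \<le> card A"
      using XY[OF v(1)] unfolding P_def x_def[symmetric] y_def[symmetric] f_def[symmetric] by auto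
    have xv: "component (R - {f}) x = component (R - {f}) v" using f(2) by (rule component_eq)
    have yA: "y \<in> A" using f(4) by auto
    define g where "g = {X y, Y y}"
    have g: "g \<in> R" "card (component (R - {g}) y) + card (component R b) \<le> card A"
      using XY[OF yA] unfolding P_def g_def[symmetric] by auto
    have yG: "y \<in> verts G" using yA subV[OF RE a] by (auto simp: A_def)
    have finy: "finite (component (R - {g}) y)" using RE yG by (intro fin) auto
    \<comment> \<open>The far side of \<open>f\<close> is compared with the side of \<open>y\<close>
      at its own bridge \<open>g\<close>, which is known to be small.\<close>
    have "card (component (R - {f}) y) \<le> card (component (R - {g}) y)"
    proof (cases "g = f")
      case False
      show ?thesis
      proof (cases "g \<subseteq> component (R - {f}) y")
        case False
        \<comment> \<open>Here the far side of \<open>f\<close> stays connected when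
          \<open>g\<close> is deleted.\<close>
        have "component (R - {f}) y = component (R - {f} - {g}) y"
          using component_delete[OF False] by simp
        also have "\<dots> \<subseteq> component (R - {g}) y" by (intro component_mono) auto
        finally show ?thesis using finy by (intro card_mono)
      next
        case True
        \<comment> \<open>If \<open>g\<close> lies on the far side of \<open>f\<close>, then the
          near side, together with \<open>f\<close> and \<open>y\<close>, avoids \<open>g\<close>.
          So the side of \<open>y\<close> at \<open>g\<close> is larger than that of
          \<open>v\<close> at \<open>f\<close>, against the choice of \<open>v\<close>.\<close>
        have "g \<noteq> {}" using g(1) RE G by (auto simp: simple_graph_def)
        moreover have "component (R - {f}) v \<inter> component (R - {f}) y = {}"
          using f(3) by (rule component_disjoint)
        ultimately have "\<not> g \<subseteq> component (R - {f}) x" using True xv by auto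
        then have "component (R - {f}) x = component (R - {f} - {g}) x"
          using component_delete by metis
        also have "\<dots> \<subseteq> component (R - {g}) x" by (intro component_mono) auto
        also have "\<dots> = component (R - {g}) y"
        proof (rule component_eq)
          have "{y, x} \<in> R - {g}" using f(1) False unfolding f_def insert_commute[of x] by simp
          then show "x \<in> component (R - {g}) y" by (rule component_edge) simp
        qed
        finally have "insert y (component (R - {f}) x) \<subseteq> component (R - {g}) y" by auto
        then have "card (insert y (component (R - {f}) x)) \<le> m y"
          unfolding m_def g_def[symmetric] using finy by (intro card_mono)
        moreover have "finite (component (R - {f}) x)"
          using f(4) finA xv by (metis finite_Un)
        ultimately have "m v < m y"
          using f(3) xv by (simp add: m_def x_def[symmetric] y_def[symmetric] f_def[symmetric])
        then show ?thesis using v(2)[OF yA] by simp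
      qed
    qed simp
    then have "card (component (R - {f}) y) + card (component R b) \<le> card A" using g(2) by simp
    then show thesis using that[of x y] f xv by (simp add: f_def A_def)
  next
    case False
    have pos: "card (component R u) > 0" if "u \<in> verts G" for u
      using fin[OF RE that] by (simp add: card_gt_0_iff)
    have b1: "card (component R b) = 1" using False pos[OF b(1)] by simp
    have "R \<noteq> {}" using R ne by (auto simp: transversal_def)
    then obtain e where e: "e \<in> R" by blast
    then obtain u w where "e = {u, w}" and uw: "u \<in> verts G" "u \<noteq> w"
      using simple_graph_edgeE[OF G] RE by (metis subsetD)
    then have uwR: "{u, w} \<in> R" using e by simp
    have "card {u, w} \<le> card (component R u)"
      using component_edge[OF uwR] fin[OF RE uw(1)] by (intro card_mono) auto
    \<comment> \<open>Components outside \<open>A\<close> are single vertices here, so every edge of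
      \<open>R\<close> lies in \<open>A\<close>.\<close>
    then have uA: "u \<in> A" using bmax[OF uw(1)] b1 uw(2) by (auto simp: A_def)
    then have wA: "w \<in> A" unfolding A_def by (rule component_edge[OF uwR])
    have "{b, u} \<in> edges G \<or> {b, w} \<in> edges G" using nonadj[of u w b] uwR RE b(1) by auto
    then obtain v where "v \<in> A" "{v, b} \<in> edges G" using uA wA by (auto simp: insert_commute)
    then obtain x y where xy: "P v x y" using exP[of v b] b by (auto simp: A_def)
    let ?R0 = "R - {{x, y}}"
    have xv: "component ?R0 x = component ?R0 v"
      using xy by (intro component_eq) (simp add: P_def)
    have disj: "component ?R0 v \<inter> component ?R0 y = {}"
      using xy by (intro component_disjoint) (simp add: P_def)
    have "finite A" unfolding A_def by (rule fin[OF RE a])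
    then have finR: "finite (component ?R0 v)" "finite (component ?R0 y)"
      using xy unfolding P_def by (metis finite_Un)+
    then have "card A = card (component ?R0 v) + card (component ?R0 y)"
      using xy disj by (simp add: P_def card_Un_disjoint)
    \<comment> \<open>As the component of \<open>b\<close> has size 1, the missing bound only says
      that the side of \<open>v\<close> is nonempty.\<close>
    moreover have "0 < card (component ?R0 v)"
      using finR by (simp add: card_gt_0_iff)
    ultimately have "card (component ?R0 y) + card (component R b) \<le> card A" using b1 by simp
    then show thesis using xy unfolding P_def A_def xv[symmetric]
      by (intro that[of x y]) blast+
  qed
qed

section \<open>Correspondence between colourings and graphs admissible for
  \<open>ell\<close>\<close>

definition ell_witness :: "nat \<Rightarrow> 'a ugraph \<Rightarrow> 'a ugraph \<Rightarrow> bool" where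
  "ell_witness q G H \<longleftrightarrow> spanning_subgraph H G \<and> \<not> connected_graph H \<and>
     (\<forall>C\<in>components H. \<forall>D\<in>components H. C \<noteq> D \<longrightarrow> card C + card D \<le> q)"

lemma ell_witnessI:
  assumes G: "simple_graph G" and S: "S \<subseteq> edges G"
    and ab: "a \<in> verts G" "b \<in> verts G" "b \<notin> component S a"
    and small: "\<And>u v. u \<in> verts G \<Longrightarrow> v \<in> verts G \<Longrightarrow> v \<notin> component S u \<Longrightarrow>
                  card (component S u) + card (component S v) \<le> q"
  shows "ell_witness q G (UGraph (verts G) S)"
proof -
  have H: "simple_graph (UGraph (verts G) S)"
    using G S unfolding simple_graph_def by auto
  moreover have "\<not> connected_graph (UGraph (verts G) S)" using ab by (auto simp: connected_iff)
  moreover have "card C + card D \<le> q"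
    if CD: "C \<in> component S ` verts G" "D \<in> component S ` verts G" "C \<noteq> D" for C D
  proof -
    obtain u v where uv: "u \<in> verts G" "v \<in> verts G" "C = component S u" "D = component S v"
      using CD by auto
    then have "v \<notin> component S u" using CD(3) component_eq by metis
    then show ?thesis using small uv by simp
  qed
  ultimately show ?thesis using S
    by (auto simp: ell_witness_def spanning_subgraph_def subgraph_def components_eq)
qed

text \<open>The upper bound, with an exact edge count: the graph is a transversal minus one
  bridge.\<close>

lemma ex_ell_witness_of_coloring:
  assumes G: "simple_graph G"
    and nonadj: "\<And>u v w. {u, v} \<in> edges G \<Longrightarrow> w \<in> verts G \<Longrightarrow> {w, u} \<in> edges G \<or> {w, v} \<in> edges G"
    and ne: "edges G \<noteq> {}" and q: "q < card (verts G)"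
    and c: "rainbow_free_coloring G (trees q) t c"
  shows "\<exists>H. ell_witness q G H \<and> t = Suc (card (edges H))"
proof -
  have finV: "finite (verts G)" using G by (simp add: simple_graph_def)
  have finE: "finite (edges G)" using G by (rule simple_graph_finite_edges)
  have fin: "finite (component S u)" if "S \<subseteq> edges G" "u \<in> verts G" for S u
    using component_subset_verts[OF G that] finV by (rule finite_subset)
  obtain S0 where "transversal (edges G) c S0"
    using subset_image_inj[of "c ` edges G" c "edges G"] by (auto simp: transversal_def)
  moreover obtain u0 where "u0 \<in> verts G" using q by fastforce
  \<comment> \<open>Pairs, so that one maximisation yields both the transversal and a vertex of its
    largest component.\<close>
  moreover define P where "P = (\<lambda>(S, u). transversal (edges G) c S \<and> u \<in> verts G)"
  ultimately have "P (S0, u0)" by simp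
  moreover have "\<forall>p. P p \<longrightarrow> card (component (fst p) (snd p)) < Suc (card (verts G))"
    using component_subset_verts[OF G] finV
    by (auto simp: P_def transversal_def less_Suc_eq_le intro!: card_mono)
  ultimately have "\<exists>p. P p \<and> (\<forall>p'. P p' \<longrightarrow>
      card (component (fst p') (snd p')) \<le> card (component (fst p) (snd p)))"
    by (rule ex_has_greatest_nat)
  then obtain R a where R: "transversal (edges G) c R" and a: "a \<in> verts G"
    and max: "\<And>S u. transversal (edges G) c S \<Longrightarrow> u \<in> verts G \<Longrightarrow>
                card (component S u) \<le> card (component R a)"
    by (auto simp: P_def)
  have RE: "R \<subseteq> edges G" "inj_on c R" using R by (auto simp: transversal_def)
  have le_q: "card (component R a) \<le> q"
    using rainbow_component_card_le[OF G c RE a] .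
  have "component R a \<noteq> verts G" using le_q q by auto
  then obtain b0 where "b0 \<in> verts G \<and> b0 \<notin> component R a"
    using component_subset_verts[OF G RE(1) a] by auto
  moreover have "\<forall>u. u \<in> verts G \<and> u \<notin> component R a \<longrightarrow>
      card (component R u) < Suc (card (component R a))"
    using max[OF R] by (simp add: less_Suc_eq_le)
  ultimately have "\<exists>b. (b \<in> verts G \<and> b \<notin> component R a) \<and>
      (\<forall>u. u \<in> verts G \<and> u \<notin> component R a \<longrightarrow> card (component R u) \<le> card (component R b))"
    by (rule ex_has_greatest_nat)
  then obtain b where b: "b \<in> verts G" "b \<notin> component R a"
    and bmax: "\<And>u. u \<in> verts G \<Longrightarrow> u \<notin> component R a \<Longrightarrow>
                 card (component R u) \<le> card (component R b)"
    by blast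
  obtain x y where xy: "{x, y} \<in> R" "y \<notin> component (R - {{x, y}}) x"
    "component R a = component (R - {{x, y}}) x \<union> component (R - {{x, y}}) y"
    "card (component (R - {{x, y}}) x) + card (component R b) \<le> card (component R a)"
    "card (component (R - {{x, y}}) y) + card (component R b) \<le> card (component R a)"
    using ex_bridge_small_sides[OF G nonadj R max a b bmax ne] by blast
  define S where "S = R - {{x, y}}"
  note xy = xy[folded S_def]
  have SE: "S \<subseteq> edges G" using RE by (auto simp: S_def)
  have V: "x \<in> verts G" "y \<in> verts G"
    using xy(1) RE simple_graph_edge_subset[OF G] by auto
  have cardA: "card (component R a) = card (component S x) + card (component S y)"
    using xy(3) component_disjoint[OF xy(2)] fin[OF SE] V by (simp add: card_Un_disjoint)
  have out: "card (component S u) \<le> card (component R b)"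
    if "u \<in> verts G" "u \<notin> component R a" for u
  proof -
    have "card (component S u) \<le> card (component R u)"
      using fin[OF RE(1) that(1)] by (intro card_mono component_mono) (auto simp: S_def)
    then show ?thesis using bmax[OF that] by simp
  qed
  have inn: "component S u = component S x \<or> component S u = component S y"
    if "u \<in> component R a" for u
    using that xy(3) component_eq[of u S x] component_eq[of u S y] by blast
  have "ell_witness q G (UGraph (verts G) S)"
  proof (rule ell_witnessI[OF G SE V xy(2)])
    fix u v assume uv: "u \<in> verts G" "v \<in> verts G" "v \<notin> component S u"
    have xy_le: "card (component S w) + card (component R b) \<le> q" if "w \<in> component R a" for w
      using inn[OF that] xy(4,5) le_q by auto
    show "card (component S u) + card (component S v) \<le> q"
    proof (cases "u \<in> component R a")
      case u: True
      show ?thesis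
      proof (cases "v \<in> component R a")
        case True
        have "component S u \<noteq> component S v" using uv(3) component_self[of v S] by blast
        then have "component S u = component S x \<and> component S v = component S y \<or>
            component S u = component S y \<and> component S v = component S x"
          using inn[OF u] inn[OF True] by metis
        then have "card (component S u) + card (component S v) = card (component R a)"
          using cardA by (elim disjE conjE) simp_all
        then show ?thesis using le_q by simp
      next
        case False
        then show ?thesis using xy_le[OF u] out[OF uv(2)] by simp
      qed
    next
      case u: False
      show ?thesis
      proof (cases "v \<in> component R a")
        case True
        then show ?thesis using xy_le[of v] out[OF uv(1) u] by simp
      next
        case False
        \<comment> \<open>With sides \<open>X\<close>, \<open>Y\<close> of \<open>A\<close>, the
          bound \<open>|Y| + |B| \<le> |A| = |X| + |Y|\<close> gives \<open>|B| \<le> |X|\<close>.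
          So two components outside \<open>A\<close> have at most
          \<open>2|B| \<le> |X| + |B| \<le> |A| \<le> q\<close> vertices.\<close>
        have "card (component R b) \<le> card (component S x)" using xy(5) cardA by simp
        then show ?thesis using xy(4) le_q out[OF uv(1) u] out[OF uv(2) False] by simp
      qed
    qed
  qed
  moreover have "t = Suc (card S)"
  proof -
    have "t = card (c ` edges G)" using c by (simp add: rainbow_free_coloring_def edge_coloring_def)
    also have "\<dots> = card R" using R card_image[of c R] by (simp add: transversal_def)
    also have "\<dots> = Suc (card S)"
      using xy(1) finite_subset[OF RE(1) finE] by (metis S_def card_Suc_Diff1)
    finally show ?thesis .
  qed
  ultimately show ?thesis by (intro exI[of _ "UGraph (verts G) S"]) simp
qed

lemma rainbow_free_coloring_of_ell_witness:
  assumes G: "simple_graph G" "connected_graph G" and H: "ell_witness q G H"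
  shows "\<exists>c. rainbow_free_coloring G (trees q) (Suc (card (edges H))) c"
proof -
  have V: "verts H = verts G" and sub: "edges H \<subseteq> edges G" and sH: "simple_graph H"
    and disc: "\<not> connected_graph H"
    and small: "\<And>C D. C \<in> components H \<Longrightarrow> D \<in> components H \<Longrightarrow> C \<noteq> D \<Longrightarrow> card C + card D \<le> q"
    using H by (auto simp: ell_witness_def spanning_subgraph_def subgraph_def)
  let ?F = "edges H"
  \<comment> \<open>An edge outside \<open>H\<close> is needed for the extra colour to occur; it
    exists since \<open>G\<close> is connected and \<open>H\<close> is not.\<close>
  have "?F \<noteq> edges G" using disc G(2) V by (metis connected_iff)
  then obtain e0 where e0: "e0 \<in> edges G" "e0 \<notin> ?F" using sub by auto
  have finF: "finite ?F" using sH by (rule simple_graph_finite_edges)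
  then obtain h where h: "bij_betw h ?F {0..<card ?F}"
    using ex_bij_betw_finite_nat by blast
  define c where "c e = (if e \<in> ?F then Suc (h e) else Suc (card ?F))" for e
  have cF: "c ` ?F = {1..card ?F}"
  proof -
    have "c ` ?F = Suc ` h ` ?F" by (auto simp: c_def image_iff)
    also have "\<dots> = {1..card ?F}"
      using h by (simp add: bij_betw_def image_Suc_atLeastLessThan atLeastLessThanSuc_atLeastAtMost)
    finally show ?thesis .
  qed
  have "c ` edges G = c ` ?F \<union> c ` (edges G - ?F)" using sub by auto
  also have "c ` (edges G - ?F) = {Suc (card ?F)}" using e0 by (auto simp: c_def)
  finally have "c ` edges G = {1..Suc (card ?F)}" using cF by auto
  moreover have False
    if K: "subgraph K G" "rainbow c K" "T \<in> trees q" "isomorphic K T" for K and T :: "nat ugraph"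
  proof -
    have T: "is_tree T" "card (edges T) = q" using K(3) by (auto simp: trees_def)
    have sK: "simple_graph K" "verts K \<subseteq> verts G" "edges K \<subseteq> edges G"
      using K(1) by (auto simp: subgraph_def)
    have "card (verts K) = card (verts T)"
      using K(4) bij_betw_same_card by (auto simp: isomorphic_def)
    then have big: "q < card (verts K)" using is_tree_card[OF T(1)] T(2) by simp
    have con: "connected_graph K"
      using isomorphic_connected[OF isomorphic_sym[OF K(4)]] T(1) by (simp add: is_tree_def)
    have one: "e = e'" if "e \<in> edges K - ?F" "e' \<in> edges K - ?F" for e e'
      using that inj_onD[OF K(2)[unfolded rainbow_def], of e e'] by (simp add: c_def)
    \<comment> \<open>A rainbow \<open>K\<close> has at most one edge of the extra colour, and
      \<open>a\<close>, \<open>b\<close> are its ends; without such an edge,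
      \<open>b = a\<close>.\<close>
    have "\<exists>a\<in>verts G. \<exists>b\<in>verts G. verts K \<subseteq> component ?F a \<union> component ?F b"
    proof (cases "edges K \<subseteq> ?F")
      case True
      obtain a where "a \<in> verts K" using con by (auto simp: connected_graph_def)
      then show ?thesis using con sK(2) component_mono[OF True, of a]
        by (intro bexI[of _ a]) (auto simp: connected_iff)
    next
      case False
      then obtain e where e: "e \<in> edges K" "e \<notin> ?F" by auto
      then obtain a b where ab: "a \<in> verts K" "b \<in> verts K" "e = {a, b}"
        using sK(1) by (auto simp: simple_graph_def)
      have "edges K \<subseteq> insert {a, b} ?F" using one e ab(3) by blast
      then have "verts K \<subseteq> component (insert {a, b} ?F) a"
        using con ab(1) component_mono[of "edges K" "insert {a, b} ?F" a] by (auto simp: connected_iff)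
      then show ?thesis using component_insert[of a b ?F a] ab sK(2)
        by (intro bexI[of _ a] bexI[of _ b]) auto
    qed
    then obtain a b where ab: "a \<in> verts H" "b \<in> verts H"
      "verts K \<subseteq> component ?F a \<union> component ?F b" using V by auto
    have fin: "finite (component ?F u)" if "u \<in> verts H" for u
      using component_subset_verts[OF sH order_refl that] sH
      by (auto simp: simple_graph_def intro: finite_subset)
    have comps: "component ?F u \<in> components H" if "u \<in> verts H" for u
      using that by (simp add: components_eq[OF sH])
    have "card (component ?F a \<union> component ?F b) \<le> q"
    proof (cases "component ?F a = component ?F b")
      case False
      then show ?thesis using small[OF comps[OF ab(1)] comps[OF ab(2)]] card_Un_le le_trans by blast
    next
      case True
      \<comment> \<open>A single component is bounded by pairing it with another one, which exists
        because \<open>H\<close> is disconnected.\<close>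
      obtain u w where u: "u \<in> verts H" "w \<in> verts H" "w \<notin> component ?F u"
        using disc ab(1) by (auto simp: connected_iff)
      then have "component ?F u \<noteq> component ?F w" using component_self[of w ?F] by blast
      then obtain z where "z \<in> verts H" "component ?F z \<noteq> component ?F a" using u(1,2) by force
      then show ?thesis using small[OF comps comps, of a z] ab True by simp
    qed
    moreover have "card (verts K) \<le> card (component ?F a \<union> component ?F b)"
      using ab fin by (intro card_mono) auto
    ultimately show False using big by simp
  qed
  ultimately have "rainbow_free_coloring G (trees q) (Suc (card ?F)) c"
    unfolding rainbow_free_coloring_def edge_coloring_def by blast
  then show ?thesis by (rule exI[of _ c])
qed

text \<open>Both constructions relate colour and edge counts exactly, so the attainable numbers of
  colours are the successors of the attainable edge counts, and the maxima correspond.\<close>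

lemma anti_ramsey_trees_eq_ell:
  assumes G: "simple_graph G"
    and nonadj: "\<And>u v w. {u, v} \<in> edges G \<Longrightarrow> w \<in> verts G \<Longrightarrow> {w, u} \<in> edges G \<or> {w, v} \<in> edges G"
    and ne: "edges G \<noteq> {}" and q: "2 \<le> q" "q < card (verts G)"
  shows "anti_ramsey G (trees q) = ell q G + 1"
proof -
  define L where "L = {card (edges H) | H. ell_witness q G H}"
  define A where "A = {t. \<exists>c. rainbow_free_coloring G (trees q) t c}"
  obtain e where "e \<in> edges G" using ne by auto
  then obtain a b where ab: "{a, b} \<in> edges G" "a \<in> verts G" "b \<in> verts G" "a \<noteq> b"
    using simple_graph_edgeE[OF G] by metis
  have b: "b \<in> component (edges G) a" using component_edge[OF ab(1)] by simp
  \<comment> \<open>Every vertex is adjacent to an end of the edge \<open>{a, b}\<close>, so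
    \<open>G\<close> is connected.\<close>
  have "w \<in> component (edges G) a" if "w \<in> verts G" for w
    using nonadj[OF ab(1) that] b component_edge[of a w "edges G" a] component_edge[of b w "edges G" a]
    by (auto simp: insert_commute)
  then have "verts G \<subseteq> component (edges G) u" if "u \<in> verts G" for u
    using component_eq[of u "edges G" a] that by auto
  then have con: "connected_graph G" using ab(2) by (auto simp: connected_iff)
  have "component {} u = {u}" for u :: 'a by (auto elim: component_induct)
  \<comment> \<open>The components of the edgeless graph are singletons, so \<open>2 \<le> q\<close>
    makes it admissible.\<close>
  then have "ell_witness q G (UGraph (verts G) {})"
    using G ab q(1) by (intro ell_witnessI[of _ _ a b]) auto
  then have "L \<noteq> {}" by (auto simp: L_def)
  moreover have "finite L"
  proof (rule finite_subset)
    show "L \<subseteq> {..card (edges G)}"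
      using simple_graph_finite_edges[OF G]
      by (auto simp: L_def ell_witness_def spanning_subgraph_def subgraph_def intro: card_mono)
  qed simp
  moreover have A: "A = Suc ` L"
    using rainbow_free_coloring_of_ell_witness[OF G con] ex_ell_witness_of_coloring[OF G nonadj ne q(2)]
    by (fastforce simp: A_def L_def image_iff)
  ultimately have "Max A = Suc (Max L)" by (simp add: mono_Max_commute mono_Suc)
  moreover have "\<exists>t c. rainbow_free_coloring G (trees q) t c" using A \<open>L \<noteq> {}\<close> by (auto simp: A_def)
  ultimately show ?thesis by (simp add: anti_ramsey_def ell_def A_def L_def ell_witness_def)
qed

section \<open>Complete multipartite graphs\<close>

lemma simple_graph_complete_multipartite: "simple_graph (complete_multipartite k p)"
proof -
  have "u \<noteq> v" if "fst u \<noteq> fst v" for u v :: "nat \<times> nat" using that by auto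
  moreover have "finite (SIGMA i:{1..k}. {1..p i})" by simp
  ultimately show ?thesis unfolding simple_graph_def complete_multipartite_def Let_def by fastforce
qed

theorem theorem2p4:
  fixes k n q :: nat and p :: "nat \<Rightarrow> nat"
  assumes "2 \<le> k"
    and "\<And>i. i \<in> {1..k} \<Longrightarrow> 0 < p i"
    and "n = (\<Sum>i=1..k. p i)"
    and "2 \<le> q" and "q \<le> n - 1"
  shows "anti_ramsey (complete_multipartite k p) (trees q) =
         ell q (complete_multipartite k p) + 1"
proof (rule anti_ramsey_trees_eq_ell)
  let ?V = "SIGMA i:{1..k}. {1..p i}"
  have verts: "verts (complete_multipartite k p) = ?V"
    by (simp add: complete_multipartite_def Let_def)
  have edges: "{u, v} \<in> edges (complete_multipartite k p) \<longleftrightarrow>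
      u \<in> ?V \<and> v \<in> ?V \<and> fst u \<noteq> fst v" for u v
    unfolding complete_multipartite_def Let_def ugraph.sel mem_Collect_eq
    by (metis doubleton_eq_iff)
  show "simple_graph (complete_multipartite k p)" by (rule simple_graph_complete_multipartite)
  \<comment> \<open>The vertex \<open>w\<close> cannot share a partite set with both
    \<open>u\<close> and \<open>v\<close>.\<close>
  show "{w, u} \<in> edges (complete_multipartite k p) \<or> {w, v} \<in> edges (complete_multipartite k p)"
    if "{u, v} \<in> edges (complete_multipartite k p)" "w \<in> verts (complete_multipartite k p)" for u v w
    using that unfolding edges verts by metis
  have "{(1, 1), (2, 1)} \<in> edges (complete_multipartite k p)"
    using assms(1) assms(2)[of 1] assms(2)[of 2] by (simp add: edges)
  then show "edges (complete_multipartite k p) \<noteq> {}" by blast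
  have "card ?V = n" using assms(3) by simp
  \<comment> \<open>\<open>2 \<le> q \<le> n - 1\<close> excludes \<open>n = 0\<close>, so the
    truncated subtraction does no harm.\<close>
  then show "q < card (verts (complete_multipartite k p))" using assms(4,5) verts by simp
qed (rule assms(4))

end
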